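(* (1) Let $k\ge 3$, let $\tau:\mathbb{Z}/k\mathbb{Z}\to\mathcal{C}_k$ be a faithful representation, where $\mathcal{C}_k\subset O(\mathbb{R}^2)$ is the group generated by the rotation by $2\pi/k$ about the origin, let $(H,\psi)$ be a finite $\mathbb{Z}/k\mathbb{Z}$-gain graph, let $\tilde p:V(H)\to\mathbb{R}^2$ be $\mathcal{C}_k$-regular, and let $0\le j\le k-1$. If $O_j(H,\psi,\tilde p)$ is row independent, then $(H,\psi)$ is $(2,3,0)$-gain-sparse. Moreover, if $j=1$ or $j=k-1$, then $O_j(H,\psi,\tilde p)$ has a kernel of dimension at least $1$, and (if $O_j(H,\psi,\tilde p)$ is row independent) $(H,\psi)$ is $(2,3,1)$-gain-sparse. (2) Similarly, let $k=2$, let $\tau:\mathbb{Z}/2\mathbb{Z}\to\mathcal{C}_2$ be a faithful representation, let $(H,\psi)$ be a finite $\mathbb{Z}/2\mathbb{Z}$-gain graph and let $\tilde p:V(H)\to\mathbb{R}^2$ be $\mathcal{C}_2$-regular. If $O_1(H,\psi,\tilde p)$ is row independent, then $(H,\psi)$ is $(2,3,2)$-gain-sparse.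
   Context: A $\Gamma$-gain graph $(H,\psi)$ is a directed multigraph $H$ (loops and parallel edges allowed, nonempty vertex set) with a map $\psi:E(H)\to\Gamma$; the orientation is only a reference, reversing an edge inverts its gain. Here $\Gamma=\mathbb{Z}/k\mathbb{Z}$. Gain-sparsity: a cycle (a loop is a cycle, two parallel edges form a cycle) is balanced if the product of its edge gains along the cycle (inverted for edges traversed backwards; for the additive group $\mathbb{Z}/k\mathbb{Z}$, the signed sum) is the identity. $F\subseteq E(H)$ is balanced if all cycles in $F$ are balanced. $V(F)$ is the set of endpoints of edges in $F$. $(H,\psi)$ is $(k',\ell,m)$-gain-sparse if $|F|\le k'|V(F)|-\ell$ for every nonempty balanced $F\subseteq E(H)$ and $|F|\le k'|V(F)|-m$ for every nonempty $F\subseteq E(H)$. Orbit rigidity matrix $O_j(H,\psi,\tilde p)$: with $\omega=e^{2\pi\sqrt{-1}/k}$, it is the $|E(H)|\times 2|V(H)|$ complex matrix whose row for $\tilde e=(\tilde u,\tilde v)$ has $(\tilde p(\tilde u)-\tau(\psi(\tilde e))\tilde p(\tilde v))^\top$ in the two columns of $\tilde u$, $\omega^{j\psi(\tilde e)}(\tilde p(\tilde v)-\tau(\psi(\tilde e))^{-1}\tilde p(\tilde u))^\top$ in the two columns of $\tilde v$, and $0$ elsewhere; for a loop at $\tilde v$ the entries in the columns of $\tilde v$ are the sum of these two vectors. Row independent means the rows are linearly independent (over $\mathbb{C}$); the kernel is the subspace of $(\mathbb{C}^2)^{V(H)}$ annihilated by the matrix. Regularity: the covering graph $G$ of $(H,\psi)$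 has vertex set $\Gamma\times V(H)$ (write $gv$ for $(g,v)$) and edges $\{g\tilde u,g\psi(\tilde e)\tilde v\}$ for $\tilde e=(\tilde u,\tilde v)\in E(H)$, $g\in\Gamma$. A map $\tilde p:V(H)\to\mathbb{R}^2$ determines $p:V(G)\to\mathbb{R}^2$ by $p(g\tilde v)=\tau(g)\tilde p(\tilde v)$. The rigidity matrix $R(G,p)$ has, for each edge $\{u,v\}$ of $G$, a row with $(p(u)-p(v))^\top$ in the columns of $u$, $(p(v)-p(u))^\top$ in the columns of $v$, and $0$ elsewhere (degenerate edges with both ends equal contribute a zero row). $\tilde p$ is $\mathcal{C}_k$-regular if $\operatorname{rank}R(G,p)$ is maximal among all maps $p$ arising in this way from maps $V(H)\to\mathbb{R}^2$.
   Formalization: In the "Moreover" part, τ(1) is additionally assumed to be the rotation by 2π/k or −2π/k; for other faithful τ it fails, e.g. k=5, τ(1) the rotation by 4π/5, j=1, one vertex at a nonzero point with two loops of gains 1 and 2. *)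

theory Defs
  imports
    "HOL-Analysis.Analysis"
    "HOL-Algebra.Elementary_Groups"
    "HOL-Library.Function_Algebras"
    "Graph_Theory.Digraph"
begin

section \<open>Gain graphs and gain-sparsity\<close>

definition gain_graph ::
    "('g, 'm) monoid_scheme \<Rightarrow> ('v, 'e) pre_digraph \<Rightarrow> ('e \<Rightarrow> 'g) \<Rightarrow> bool" where
  "gain_graph \<Gamma> H \<psi> \<longleftrightarrow>
     fin_digraph H \<and> verts H \<noteq> {} \<and> \<psi> \<in> arcs H \<rightarrow> carrier \<Gamma>"

text \<open>
  Cycles ignore the reference orientation. A step \<open>(e, True)\<close> traverses the arc \<open>e\<close> from its
  tail to its head, and \<open>(e, False)\<close> traverses it backwards.
\<close>

fun step_source :: "('v, 'e) pre_digraph \<Rightarrow> 'e \<times> bool \<Rightarrow> 'v" where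
  "step_source H (e, b) = (if b then tail H e else head H e)"

fun step_target :: "('v, 'e) pre_digraph \<Rightarrow> 'e \<times> bool \<Rightarrow> 'v" where
  "step_target H (e, b) = (if b then head H e else tail H e)"

fun step_gain :: "('g, 'm) monoid_scheme \<Rightarrow> ('e \<Rightarrow> 'g) \<Rightarrow> 'e \<times> bool \<Rightarrow> 'g" where
  "step_gain \<Gamma> \<psi> (e, b) = (if b then \<psi> e else inv\<^bsub>\<Gamma>\<^esub> (\<psi> e))"

text \<open>
  Edges as well as vertices must not repeat: the former excludes going back and forth along one
  edge. Loops are the cycles of length 1, pairs of parallel edges those of length 2.
\<close>

definition is_cycle :: "('v, 'e) pre_digraph \<Rightarrow> 'e set \<Rightarrow> ('e \<times> bool) list \<Rightarrow> bool" where
  "is_cycle H F c \<longleftrightarrow>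
     c \<noteq> [] \<and> fst ` set c \<subseteq> F \<and>
     distinct (map fst c) \<and> distinct (map (step_source H) c) \<and>
     (\<forall>i < length c. step_target H (c ! i) = step_source H (c ! (Suc i mod length c)))"

definition cycle_gain ::
    "('g, 'm) monoid_scheme \<Rightarrow> ('e \<Rightarrow> 'g) \<Rightarrow> ('e \<times> bool) list \<Rightarrow> 'g" where
  "cycle_gain \<Gamma> \<psi> c = foldr (\<lambda>s g. step_gain \<Gamma> \<psi> s \<otimes>\<^bsub>\<Gamma>\<^esub> g) c \<one>\<^bsub>\<Gamma>\<^esub>"

definition balanced ::
    "('g, 'm) monoid_scheme \<Rightarrow> ('v, 'e) pre_digraph \<Rightarrow> ('e \<Rightarrow> 'g) \<Rightarrow> 'e set \<Rightarrow> bool" where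
  "balanced \<Gamma> H \<psi> F \<longleftrightarrow> (\<forall>c. is_cycle H F c \<longrightarrow> cycle_gain \<Gamma> \<psi> c = \<one>\<^bsub>\<Gamma>\<^esub>)"

definition edge_verts :: "('v, 'e) pre_digraph \<Rightarrow> 'e set \<Rightarrow> 'v set" where
  "edge_verts H F = tail H ` F \<union> head H ` F"

definition gain_sparse ::
    "('g, 'm) monoid_scheme \<Rightarrow> ('v, 'e) pre_digraph \<Rightarrow> ('e \<Rightarrow> 'g) \<Rightarrow>
     nat \<Rightarrow> nat \<Rightarrow> nat \<Rightarrow> bool" where
  "gain_sparse \<Gamma> H \<psi> k l m \<longleftrightarrow>
     (\<forall>F \<subseteq> arcs H. F \<noteq> {} \<longrightarrow>
        (balanced \<Gamma> H \<psi> F \<longrightarrow> int (card F) \<le> int k * int (card (edge_verts H F)) - int l) \<and>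
        int (card F) \<le> int k * int (card (edge_verts H F)) - int m)"


section \<open>Matrices with columns indexed by \<open>n\<close>-tuples of coordinates for each vertex\<close>

text \<open>
  A matrix is a map \<open>A\<close> from row indices to rows, where a row is a map \<open>'v \<Rightarrow> 'a ^ 'n\<close> that
  vanishes off the vertex set. Rows and vectors live in the following vector space over \<open>'a\<close>.
\<close>

definition vscale :: "'a::field \<Rightarrow> ('v \<Rightarrow> 'a ^ 'n) \<Rightarrow> 'v \<Rightarrow> 'a ^ 'n" where
  "vscale c f = (\<lambda>v. c *s f v)"

global_interpretation fvec: vector_space "vscale :: 'a::field \<Rightarrow> ('v \<Rightarrow> 'a ^ 'n) \<Rightarrow> 'v \<Rightarrow> 'a ^ 'n"
  by unfold_locales
     (auto simp: vscale_def fun_eq_iff vec_eq_iff algebra_simps)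

text \<open>Injectivity makes this independence of the family of rows, not just of the set of rows.\<close>

definition row_independent :: "('r \<Rightarrow> 'v \<Rightarrow> 'a::field ^ 'n) \<Rightarrow> 'r set \<Rightarrow> bool" where
  "row_independent A I \<longleftrightarrow> inj_on A I \<and> fvec.independent (A ` I)"

definition row_rank :: "('r \<Rightarrow> 'v \<Rightarrow> 'a::field ^ 'n) \<Rightarrow> 'r set \<Rightarrow> nat" where
  "row_rank A I = fvec.dim (A ` I)"

definition row_kernel ::
    "('r \<Rightarrow> 'v \<Rightarrow> 'a::field ^ 'n) \<Rightarrow> 'r set \<Rightarrow> 'v set \<Rightarrow> ('v \<Rightarrow> 'a ^ 'n) set" where
  "row_kernel A I V =
     {x. (\<forall>v. v \<notin> V \<longrightarrow> x v = 0) \<and> (\<forall>r\<in>I. (\<Sum>v\<in>V. \<Sum>i\<in>UNIV. A r v $ i * x v $ i) = 0)}"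


section \<open>Cyclic symmetry in the plane\<close>

definition rotation :: "real \<Rightarrow> real ^ 2 ^ 2" where
  "rotation \<theta> = vector [vector [cos \<theta>, - sin \<theta>], vector [sin \<theta>, cos \<theta>]]"

definition orthogonal_group2 :: "(real ^ 2 ^ 2) monoid" where
  "orthogonal_group2 = \<lparr>carrier = {A. orthogonal_matrix A}, mult = (**), one = mat 1\<rparr>"

definition cyclic_rotation_group :: "nat \<Rightarrow> (real ^ 2 ^ 2) monoid" where
  "cyclic_rotation_group k = subgroup_generated orthogonal_group2 {rotation (2 * pi / real k)}"

definition faithful_rep :: "nat \<Rightarrow> (int \<Rightarrow> real ^ 2 ^ 2) \<Rightarrow> bool" where
  "faithful_rep k \<tau> \<longleftrightarrow> \<tau> \<in> mon (integer_mod_group k) (cyclic_rotation_group k)"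


section \<open>Orbit rigidity matrices\<close>

definition cvec :: "real ^ 'n \<Rightarrow> complex ^ 'n" where
  "cvec x = (\<chi> i. complex_of_real (x $ i))"

text \<open>
  The row of an arc \<open>e\<close>. For a loop both summands contribute to the columns of the same vertex.
\<close>

definition orbit_matrix ::
    "nat \<Rightarrow> (int \<Rightarrow> real ^ 2 ^ 2) \<Rightarrow> nat \<Rightarrow> ('v, 'e) pre_digraph \<Rightarrow> ('e \<Rightarrow> int) \<Rightarrow>
     ('v \<Rightarrow> real ^ 2) \<Rightarrow> 'e \<Rightarrow> 'v \<Rightarrow> complex ^ 2" where
  "orbit_matrix k \<tau> j H \<psi> p e w =
     (let u = tail H e; v = head H e; \<omega> = exp (2 * of_real pi * \<i> / of_nat k) in
       (if w = u then cvec (p u - \<tau> (\<psi> e) *v p v) else 0) +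
       (if w = v then
          (\<omega> powi (int j * \<psi> e)) *s cvec (p v - matrix_inv (\<tau> (\<psi> e)) *v p u) else 0))"


section \<open>Regularity\<close>

definition covering_edges ::
    "('g, 'm) monoid_scheme \<Rightarrow> ('v, 'e) pre_digraph \<Rightarrow> ('e \<Rightarrow> 'g) \<Rightarrow> ('g \<times> 'v) set set" where
  "covering_edges \<Gamma> H \<psi> =
     {{(g, tail H e), (g \<otimes>\<^bsub>\<Gamma>\<^esub> \<psi> e, head H e)} | g e. g \<in> carrier \<Gamma> \<and> e \<in> arcs H}"

definition covering_map ::
    "('g \<Rightarrow> real ^ 2 ^ 2) \<Rightarrow> ('v \<Rightarrow> real ^ 2) \<Rightarrow> 'g \<times> 'v \<Rightarrow> real ^ 2" where
  "covering_map \<tau> p = (\<lambda>(g, v). \<tau> g *v p v)"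

text \<open>
  The row of the edge \<open>d = {u, v}\<close> is \<open>p u - p v\<close> at \<open>u\<close>, \<open>p v - p u\<close> at \<open>v\<close> and \<open>0\<close> elsewhere;
  it is the zero row if \<open>u = v\<close>.
\<close>

definition rigidity_matrix :: "('x \<Rightarrow> real ^ 2) \<Rightarrow> 'x set \<Rightarrow> 'x \<Rightarrow> real ^ 2" where
  "rigidity_matrix p d w = (if w \<in> d then \<Sum>u\<in>d. p w - p u else 0)"

definition cyclic_regular ::
    "nat \<Rightarrow> (int \<Rightarrow> real ^ 2 ^ 2) \<Rightarrow> ('v, 'e) pre_digraph \<Rightarrow> ('e \<Rightarrow> int) \<Rightarrow>
     ('v \<Rightarrow> real ^ 2) \<Rightarrow> bool" where
  "cyclic_regular k \<tau> H \<psi> p \<longleftrightarrow>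
     (\<forall>q. row_rank (rigidity_matrix (covering_map \<tau> q)) (covering_edges (integer_mod_group k) H \<psi>)
        \<le> row_rank (rigidity_matrix (covering_map \<tau> p)) (covering_edges (integer_mod_group k) H \<psi>))"

end

theory Submission
  imports Defs
begin

text \<open>
  The kernel of an orbit matrix, restricted to the vertices of an edge set \<open>F\<close>, bounds the number of
  independent rows: \<open>card F + dim (kernel) \<le> 2 * card V(F)\<close>. For a balanced \<open>F\<close> the gains are
  differences of a potential on the vertices, and switching by this potential turns the rows of \<open>F\<close>
  into rows of an ordinary rigidity matrix, so that the two translations and the infinitesimal
  rotation lie in the kernel. They are independent unless all switched points of \<open>F\<close> coincide, in
  which case \<open>F\<close> has a zero row. For arbitrary \<open>F\<close>, each constant vector \<open>z\<close> with
  \<open>\<omega>\<^sup>j \<tau>(1) z = z\<close> lies in the kernel; there is one up to scaling if \<open>j = 1\<close> or \<open>j = k - 1\<close>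
  with \<open>\<tau>(1)\<close> the rotation by \<open>\<plusminus>2\<pi>/k\<close>, and every vector is one if \<open>k = 2\<close> and \<open>j = 1\<close>.
\<close>

subsection \<open>Potentials of balanced edge sets\<close>

text \<open>A walk rather than a trail in the strict sense: edges and vertices may repeat. The empty
  list joins every vertex to itself, which makes reachability reflexive.\<close>

fun trail :: "('v, 'e) pre_digraph \<Rightarrow> 'e set \<Rightarrow> 'v \<Rightarrow> ('e \<times> bool) list \<Rightarrow> 'v \<Rightarrow> bool" where
  "trail H F a [] b \<longleftrightarrow> a = b"
| "trail H F a (s # c) b \<longleftrightarrow> fst s \<in> F \<and> step_source H s = a \<and> trail H F (step_target H s) c b"

text \<open>Summed in the integers and not reduced mod \<open>k\<close>, so that concatenation and
  reversal become plain addition and negation. Reduction happens only in the comparison with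
  \<open>cycle_gain\<close>.\<close>

definition trail_gain :: "('e \<Rightarrow> int) \<Rightarrow> ('e \<times> bool) list \<Rightarrow> int" where
  "trail_gain \<psi> c = (\<Sum>(e, b)\<leftarrow>c. if b then \<psi> e else - \<psi> e)"

definition step_flip :: "'e \<times> bool \<Rightarrow> 'e \<times> bool" where
  "step_flip s = (fst s, \<not> snd s)"

lemma trail_gain_Nil [simp]: "trail_gain \<psi> [] = 0"
  and trail_gain_Cons [simp]: "trail_gain \<psi> (s # c) = (if snd s then \<psi> (fst s) else - \<psi> (fst s)) + trail_gain \<psi> c"
  and trail_gain_append [simp]: "trail_gain \<psi> (c @ d) = trail_gain \<psi> c + trail_gain \<psi> d"
  by (simp_all add: trail_gain_def case_prod_beta)

lemma step_flip_simps [simp]: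
  "step_source H (step_flip s) = step_target H s" "step_target H (step_flip s) = step_source H s"
  "fst (step_flip s) = fst s" "snd (step_flip s) \<longleftrightarrow> \<not> snd s"
  by (cases s; simp add: step_flip_def)+

lemma trail_append: "trail H F a (c @ d) b \<longleftrightarrow> (\<exists>x. trail H F a c x \<and> trail H F x d b)"
  by (induction c arbitrary: a) auto

lemma trail_append_Cons:
  "trail H F a (c @ s # d) b \<longleftrightarrow>
     fst s \<in> F \<and> trail H F a c (step_source H s) \<and> trail H F (step_target H s) d b"
  by (auto simp: trail_append)

lemma trail_start: "trail H F a c b \<Longrightarrow> c = [] \<or> a \<in> step_source H ` set c"
  by (cases c) auto

lemma trail_edges: "trail H F a c b \<Longrightarrow> fst ` set c \<subseteq> F"
  by (induction c arbitrary: a) auto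

lemma trail_rev: "trail H F a c b \<Longrightarrow> trail H F b (rev (map step_flip c)) a"
  by (induction c arbitrary: a) (auto simp: trail_append)

lemma trail_gain_rev: "trail_gain \<psi> (rev (map step_flip c)) = - trail_gain \<psi> c"
  by (induction c) auto

lemma trail_next_source:
  assumes "trail H F a c b" "i < length c"
  shows "step_target H (c ! i) = (if Suc i < length c then step_source H (c ! Suc i) else b)"
  using assms
proof (induction c arbitrary: a i)
  case (Cons s c)
  show ?case
  proof (cases i)
    case 0
    then show ?thesis using Cons.prems by (cases c) auto
  next
    case (Suc j)
    then show ?thesis using Cons.prems Cons.IH[of "step_target H s" j] by auto
  qed
qed simp

text \<open>\<open>is_cycle\<close> compares consecutive steps cyclically; the wrap-around after the
  last step holds because the trail ends at the source of its first step.\<close>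

lemma closed_trail_is_cycle:
  assumes "trail H F a c a" "c \<noteq> []" "distinct (map (step_source H) c)" "distinct (map fst c)"
  shows "is_cycle H F c"
proof -
  have a: "step_source H (c ! 0) = a" using assms(1,2) by (cases c) auto
  have "step_target H (c ! i) = step_source H (c ! (Suc i mod length c))" if "i < length c" for i
  proof (cases "Suc i < length c")
    case False
    then have "Suc i = length c" using that by simp
    then show ?thesis using trail_next_source[OF assms(1) that] a by simp
  qed (use trail_next_source[OF assms(1) that] in simp)
  then show ?thesis unfolding is_cycle_def using assms trail_edges[OF assms(1)] by auto
qed

lemma cycle_gain_integer_mod_group:
  assumes "\<And>s. s \<in> set c \<Longrightarrow> \<psi> (fst s) \<in> carrier (integer_mod_group k)"
  shows "cycle_gain (integer_mod_group k) \<psi> c = trail_gain \<psi> c mod int k"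
  using assms
proof (induction c)
  case (Cons s c)
  then have "\<psi> (fst s) \<in> carrier (integer_mod_group k)"
    and "cycle_gain (integer_mod_group k) \<psi> c = trail_gain \<psi> c mod int k" by simp_all
  then show ?case
    by (cases s) (simp add: cycle_gain_def mod_simps)
qed (simp add: cycle_gain_def)

lemma not_distinct_map_decomp:
  assumes "\<not> distinct (map f c)"
  shows "\<exists>c1 s c2 t c3. c = c1 @ s # c2 @ t # c3 \<and> f s = f t"
  using assms
proof (induction c)
  case (Cons s c)
  show ?case
  proof (cases "f s \<in> f ` set c")
    case True
    then obtain t where "t \<in> set c" "f s = f t" by auto
    then show ?thesis by (metis append_Nil split_list)
  next
    case False
    then obtain c1 t c2 u c3 where "c = c1 @ t # c2 @ u # c3" "f t = f u"
      using Cons by auto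
    then show ?thesis by (metis append_Cons)
  qed
qed simp

lemma trail_cut:
  assumes "trail H F a (c1 @ s # c2 @ t # c3) b" "step_source H s = step_source H t"
  shows "trail H F a c1 (step_source H s)"
    and "trail H F (step_source H s) (s # c2) (step_source H s)"
    and "trail H F (step_source H s) (t # c3) b"
  using assms unfolding trail_append_Cons by simp_all

text \<open>Induction on the length. A repeated source splits off a shorter closed trail, and gains
  add up. With distinct sources the trail is empty, or a cycle in \<open>F\<close>, or one edge
  traversed forth and back, with gain 0.\<close>

lemma closed_trail_gain:
  assumes "balanced (integer_mod_group k) H \<psi> F" "\<psi> \<in> F \<rightarrow> carrier (integer_mod_group k)"
    and "trail H F a c a"
  shows "int k dvd trail_gain \<psi> c"
  using assms(3)
proof (induction "length c" arbitrary: a c rule: less_induct)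
  case less
  show ?case
  proof (cases "distinct (map (step_source H) c)")
    case False
    then obtain c1 s c2 t c3 where c: "c = c1 @ s # c2 @ t # c3"
      and st: "step_source H s = step_source H t"
      using not_distinct_map_decomp[OF False] by blast
    note tr = trail_cut[OF less.prems[unfolded c] st]
    have "int k dvd trail_gain \<psi> (s # c2)"
      by (rule less.hyps[OF _ tr(2)]) (simp add: c)
    moreover have "trail H F a (c1 @ t # c3) a" using tr unfolding trail_append by blast
    then have "int k dvd trail_gain \<psi> (c1 @ t # c3)"
      by (rule less.hyps[rotated]) (simp add: c)
    moreover have "trail_gain \<psi> c = trail_gain \<psi> (s # c2) + trail_gain \<psi> (c1 @ t # c3)"
      by (simp add: c)
    ultimately show ?thesis by (metis dvd_add)
  next
    case src: True
    show ?thesis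
    proof (cases "distinct (map fst c)")
      case True
      show ?thesis
      proof (cases "c = []")
        case False
        have "is_cycle H F c" using closed_trail_is_cycle[OF less.prems False src True] .
        then have "cycle_gain (integer_mod_group k) \<psi> c = 0"
          using assms(1) by (simp add: balanced_def)
        moreover have "cycle_gain (integer_mod_group k) \<psi> c = trail_gain \<psi> c mod int k"
          using trail_edges[OF less.prems] assms(2) by (intro cycle_gain_integer_mod_group) auto
        ultimately show ?thesis by auto
      qed simp
    next
      case False
      then obtain c1 s c2 t c3 where c: "c = c1 @ s # c2 @ t # c3" and st: "fst s = fst t"
        using not_distinct_map_decomp[OF False] by blast
      have ne: "step_source H s \<noteq> step_source H t" using src c by auto
      have "snd s \<noteq> snd t" using st ne prod_eqI[of s t] by auto
      then have t: "t = step_flip s" using st by (simp add: step_flip_def prod_eq_iff)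
      \<comment> \<open>Backtracking along an edge with all sources distinct leaves no room for further steps.\<close>
      have tr: "trail H F a c1 (step_source H s)" "trail H F (step_source H t) c2 (step_source H t)"
        "trail H F (step_source H s) c3 a"
        using less.prems unfolding c trail_append_Cons by (simp_all add: t)
      have notin: "step_source H s \<notin> step_source H ` set c1" "step_source H t \<notin> step_source H ` set c2"
        "step_source H s \<notin> step_source H ` set c3"
        using src unfolding c by auto
      have "c2 = []" "c3 = []" using trail_start[OF tr(2)] trail_start[OF tr(3)] notin by blast+
      moreover from this have "a = step_source H s" using tr(3) by simp
      then have "c1 = []" using trail_start[OF tr(1)] notin by blast
      ultimately show ?thesis by (simp add: c t)
    qed
  qed
qed

text \<open>Fix a root in each component; the potential of \<open>b\<close> is the gain of a chosen
  trail from the root to \<open>b\<close>. Modulo \<open>k\<close> the choice is irrelevant because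
  closed trails have gain 0.\<close>

lemma balanced_potential:
  assumes "balanced (integer_mod_group k) H \<psi> F" "\<psi> \<in> F \<rightarrow> carrier (integer_mod_group k)"
  obtains h where "\<And>e. e \<in> F \<Longrightarrow> int k dvd \<psi> e - (h (head H e) - h (tail H e))"
proof -
  define R where "R a b \<longleftrightarrow> (\<exists>c. trail H F a c b)" for a b
  \<comment> \<open>Vertices of one component satisfy the same predicate
    \<open>\<lambda>a. R a b\<close>, so the choice operator returns literally the same root for
    them.\<close>
  define r where "r b = (SOME a. R a b)" for b
  define w where "w b = (SOME c. trail H F (r b) c b)" for b
  have "R b b" for b unfolding R_def by (rule exI[of _ "[]"]) simp
  then have "R (r b) b" for b unfolding r_def by (rule someI)
  then have w: "trail H F (r b) (w b) b" for b unfolding w_def R_def by (rule someI_ex)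
  have "int k dvd \<psi> e - (trail_gain \<psi> (w (head H e)) - trail_gain \<psi> (w (tail H e)))" if e: "e \<in> F" for e
  proof -
    let ?u = "tail H e" and ?v = "head H e"
    have tr: "trail H F ?u [(e, True)] ?v" using e by simp
    have "R a ?u \<longleftrightarrow> R a ?v" for a
      using tr trail_rev[OF tr] unfolding R_def by (metis trail_append)
    then have "r ?u = r ?v" by (simp add: r_def)
    \<comment> \<open>Follow \<open>e\<close>, return from its head to the common root, then go out
      to its tail. The gain of this closed trail is the difference to be shown divisible.\<close>
    then have "trail H F ?u ([(e, True)] @ rev (map step_flip (w ?v)) @ w ?u) ?u"
      using tr trail_rev[OF w[of ?v]] w[of ?u] unfolding trail_append by metis
    from closed_trail_gain[OF assms this] show ?thesis
      by (simp add: trail_gain_rev algebra_simps)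
  qed
  then show ?thesis using that[of "\<lambda>b. trail_gain \<psi> (w b)"] by blast
qed

subsection \<open>Independent rows and the kernel\<close>

text \<open>Bilinear even over the complex numbers, to agree with the product in
  \<open>row_kernel\<close>.\<close>

definition pairing :: "'v set \<Rightarrow> ('v \<Rightarrow> 'a::field ^ 'n) \<Rightarrow> ('v \<Rightarrow> 'a ^ 'n) \<Rightarrow> 'a" where
  "pairing W f x = (\<Sum>v\<in>W. \<Sum>i\<in>UNIV. f v $ i * x v $ i)"

definition fcnj :: "('v \<Rightarrow> complex ^ 'n) \<Rightarrow> 'v \<Rightarrow> complex ^ 'n" where
  "fcnj x = (\<lambda>v. \<chi> i. cnj (x v $ i))"

lemma pairing_add [simp]: "pairing W (f + g) x = pairing W f x + pairing W g x"
  and pairing_vscale [simp]: "pairing W (vscale c f) x = c * pairing W f x"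
  and pairing_0 [simp]: "pairing W 0 x = 0"
  and pairing_add_right [simp]: "pairing W f (x + y) = pairing W f x + pairing W f y"
  and pairing_vscale_right [simp]: "pairing W f (vscale c x) = c * pairing W f x"
  and pairing_0_right [simp]: "pairing W f 0 = 0"
  by (simp_all add: pairing_def vscale_def algebra_simps sum.distrib sum_subtractf sum_distrib_left)

lemma fcnj_simps [simp]:
  "fcnj (f + g) = fcnj f + fcnj g" "fcnj (f - g) = fcnj f - fcnj g" "fcnj 0 = 0"
  "fcnj (vscale c f) = vscale (cnj c) (fcnj f)" "fcnj (fcnj f) = f"
  by (auto simp: fcnj_def vscale_def fun_eq_iff vec_eq_iff)

lemma fcnj_eq_iff [simp]: "fcnj f = fcnj g \<longleftrightarrow> f = g"
  by (metis fcnj_simps(5))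

text \<open>The product is the sum of the squared moduli of the coordinates of \<open>x\<close> over
  \<open>W\<close>, so conjugating one argument restores definiteness.\<close>

lemma pairing_fcnj_eq_0:
  assumes "finite W" "pairing W (fcnj x) x = 0" "v \<in> W"
  shows "x v = 0"
proof -
  have "of_real (\<Sum>v\<in>W. \<Sum>i\<in>UNIV. (cmod (x v $ i))\<^sup>2) = pairing W (fcnj x) x"
    unfolding pairing_def fcnj_def of_real_sum complex_norm_square by (simp add: mult.commute)
  then have "(\<Sum>v\<in>W. \<Sum>i\<in>UNIV. (cmod (x v $ i))\<^sup>2) = 0"
    using assms(2) by (metis of_real_eq_0_iff)
  then have "(\<Sum>i\<in>UNIV. (cmod (x v $ i))\<^sup>2) = 0"
    using assms(1,3) by (subst (asm) sum_nonneg_eq_0_iff) (auto intro: sum_nonneg)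
  then show ?thesis
    by (subst (asm) sum_nonneg_eq_0_iff) (auto simp: vec_eq_iff)
qed

lemma span_fcnj:
  assumes "x \<in> fvec.span (fcnj ` K)"
  shows "fcnj x \<in> fvec.span K"
  using assms
proof (induction rule: fvec.span_induct_alt)
  case base
  show "fcnj 0 \<in> fvec.span K" using fvec.span_zero unfolding fcnj_simps .
next
  case (step c a b)
  then have "fcnj a \<in> K" by auto
  then have "vscale (cnj c) (fcnj a) + fcnj b \<in> fvec.span K"
    by (rule fvec.span_add[OF fvec.span_scale[OF fvec.span_base] step(2)])
  then show "fcnj (vscale c a + b) \<in> fvec.span K" unfolding fcnj_simps .
qed

lemma row_kernel_iff:
  "x \<in> row_kernel A I W \<longleftrightarrow> (\<forall>v. v \<notin> W \<longrightarrow> x v = 0) \<and> (\<forall>r\<in>I. pairing W (A r) x = 0)"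
  by (simp add: row_kernel_def pairing_def)

lemma subspace_row_kernel: "fvec.subspace (row_kernel A I W)"
  by (auto simp: fvec.subspace_def row_kernel_iff) (auto simp: vscale_def)

text \<open>The standard basis of the vectors supported in \<open>W\<close>. The ambient function
  space may have infinite dimension, so bounds on cardinalities go through this finite spanning
  set.\<close>

definition coord_vectors :: "'v set \<Rightarrow> ('v \<Rightarrow> 'a::field ^ 'n) set" where
  "coord_vectors W = (\<lambda>(v, i) w. if w = v then axis i 1 else 0) ` (W \<times> UNIV)"

lemma finite_coord_vectors: "finite W \<Longrightarrow> finite (coord_vectors W)"
  by (simp add: coord_vectors_def)

lemma card_coord_vectors:
  assumes "finite W"
  shows "card (coord_vectors W :: ('v \<Rightarrow> 'a::field ^ 'n) set) \<le> CARD('n) * card W"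
  using card_image_le[of "W \<times> (UNIV :: 'n set)"] assms
  by (auto simp: coord_vectors_def card_cartesian_product mult.commute)

lemma sum_fun_apply: "(\<Sum>a\<in>S. f a) x = (\<Sum>a\<in>S. f a x)"
  by (induction S rule: infinite_finite_induct) auto

lemma supported_in_span_coord_vectors:
  fixes f :: "'v \<Rightarrow> 'a::field ^ 'n"
  assumes "finite W" "\<And>v. v \<notin> W \<Longrightarrow> f v = 0"
  shows "f \<in> fvec.span (coord_vectors W)"
proof -
  have "f = (\<Sum>(v, i)\<in>W \<times> UNIV. vscale (f v $ i) (\<lambda>w. if w = v then axis i 1 else 0))"
  proof
    fix w
    have "(\<Sum>(v, i)\<in>W \<times> UNIV. vscale (f v $ i) (\<lambda>w. if w = v then axis i 1 else 0)) w
        = (\<Sum>v\<in>W. if w = v then (\<Sum>i\<in>UNIV. f v $ i *s axis i 1) else 0)"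
      unfolding sum.cartesian_product[symmetric] sum_fun_apply
      by (intro sum.cong refl) (auto simp: sum_fun_apply vscale_def)
    also have "\<dots> = f w"
      using assms by (auto simp: basis_expansion)
    finally show "f w = (\<Sum>(v, i)\<in>W \<times> UNIV. vscale (f v $ i) (\<lambda>w. if w = v then axis i 1 else 0)) w"
      by simp
  qed
  also have "\<dots> \<in> fvec.span (coord_vectors W)"
  proof (intro fvec.span_sum)
    fix a :: "'v \<times> 'n" assume "a \<in> W \<times> UNIV"
    then have "(\<lambda>w. if w = fst a then axis (snd a) 1 else 0) \<in> coord_vectors W"
      unfolding coord_vectors_def by force
    then show "(case a of (v, i) \<Rightarrow> vscale (f v $ i) (\<lambda>w. if w = v then axis i 1 else 0))
        \<in> fvec.span (coord_vectors W)"
      unfolding case_prod_beta by (intro fvec.span_scale fvec.span_base)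
  qed
  finally show ?thesis .
qed

text \<open>
  Over \<open>\<complex>\<close> the pairing is not definite, so it is the complex conjugates of kernel vectors that
  are independent of the rows.
\<close>

lemma independent_rows_un_kernel:
  assumes "finite W" "fvec.independent R" "finite K" "fvec.independent K"
    and "\<And>r x. r \<in> R \<Longrightarrow> x \<in> K \<Longrightarrow> pairing W r x = 0"
    and "\<And>v x. x \<in> K \<Longrightarrow> v \<notin> W \<Longrightarrow> x v = 0"
  shows "fvec.independent (R \<union> fcnj ` K) \<and> R \<inter> fcnj ` K = {}"
  using assms(3-)
proof (induction K)
  case (insert x K)
  \<comment> \<open>With \<open>id\<close> as the row map, the set \<open>R\<close> of rows indexes
    itself.\<close>
  have ker: "K' \<subseteq> K \<union> {x} \<Longrightarrow> fvec.span K' \<subseteq> row_kernel id R W" for K'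
    by (rule fvec.span_minimal[OF _ subspace_row_kernel]) (use insert.prems in \<open>auto simp: row_kernel_iff\<close>)
  have "x \<notin> fvec.span K" "fvec.independent K"
    using insert.prems(1) insert.hyps by (auto simp: fvec.independent_insert)
  \<comment> \<open>If \<open>fcnj x = r + y\<close> with \<open>r\<close> and \<open>y\<close> in
    the two spans, then \<open>d = x - fcnj y\<close> lies in the kernel and
    \<open>r = fcnj d\<close>. Pairing \<open>r\<close> with \<open>d\<close> gives 0, so
    \<open>d = 0\<close> and \<open>x\<close> is in the span of \<open>K\<close>, a
    contradiction.\<close>
  have notin_span: "fcnj x \<notin> fvec.span (R \<union> fcnj ` K)"
  proof
    assume "fcnj x \<in> fvec.span (R \<union> fcnj ` K)"
    then obtain r y where r: "r \<in> fvec.span R" and "y \<in> fvec.span (fcnj ` K)" "fcnj x = r + y"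
      unfolding fvec.span_Un by blast
    then have y: "fcnj y \<in> fvec.span K" and r_eq: "r = fcnj (x - fcnj y)"
      by (simp_all add: span_fcnj)
    have "fcnj y \<in> fvec.span (insert x K)"
      using y fvec.span_mono[of K "insert x K"] by blast
    then have "x - fcnj y \<in> fvec.span (insert x K)"
      by (rule fvec.span_diff[OF fvec.span_base, rotated]) simp
    then have d: "x - fcnj y \<in> row_kernel id R W" using ker[of "insert x K"] by blast
    have "pairing W r (x - fcnj y) = 0"
      using r
    proof (induction rule: fvec.span_induct_alt)
      case base
      show "pairing W 0 (x - fcnj y) = 0" unfolding pairing_0 ..
    next
      case (step c a b)
      moreover have "pairing W a (x - fcnj y) = 0"
        using d step(1) unfolding row_kernel_iff id_apply by blast
      ultimately show "pairing W (vscale c a + b) (x - fcnj y) = 0"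
        unfolding pairing_add pairing_vscale by (simp only: mult_zero_right add_0_right)
    qed
    then have "(x - fcnj y) v = 0" if "v \<in> W" for v
      using pairing_fcnj_eq_0[OF assms(1) _ that, of "x - fcnj y"] unfolding r_eq by blast
    moreover have "(x - fcnj y) v = 0" if "v \<notin> W" for v
      using d that by (simp add: row_kernel_iff)
    ultimately have "(x - fcnj y) v = 0 v" for v
      by (cases "v \<in> W") simp_all
    then have "x - fcnj y = 0" by (rule ext)
    then show False using y \<open>x \<notin> fvec.span K\<close> by simp
  qed
  have IH: "fvec.independent (R \<union> fcnj ` K)" "R \<inter> fcnj ` K = {}"
    using insert.IH insert.prems \<open>fvec.independent K\<close> by simp_all
  have notin: "fcnj x \<notin> R \<union> fcnj ` K"
    using fvec.span_base notin_span by (rule contrapos_nn[rotated])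
  have "fvec.independent (insert (fcnj x) (R \<union> fcnj ` K))"
    using notin_span IH(1) by (rule fvec.independent_insertI)
  then show ?case using notin IH(2) by simp
qed (use assms(2) in simp)

text \<open>One half of rank-nullity: the rows and the conjugated kernel vectors are jointly
  independent in the space of vectors supported in \<open>W\<close>.\<close>

lemma card_rows_plus_card_kernel_le:
  fixes A :: "'r \<Rightarrow> 'v \<Rightarrow> complex ^ 'n"
  assumes "finite W" "finite I" "row_independent A I"
    and "\<And>r v. r \<in> I \<Longrightarrow> v \<notin> W \<Longrightarrow> A r v = 0"
    and "finite K" "fvec.independent K" "K \<subseteq> row_kernel A I W"
  shows "card I + card K \<le> CARD('n) * card W"
proof -
  have A: "inj_on A I" "fvec.independent (A ` I)"
    using assms(3) by (auto simp: row_independent_def)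
  have *: "fvec.independent (A ` I \<union> fcnj ` K) \<and> A ` I \<inter> fcnj ` K = {}"
    using assms A by (intro independent_rows_un_kernel[of W]) (auto simp: row_kernel_iff)
  have "A ` I \<union> fcnj ` K \<subseteq> fvec.span (coord_vectors W)"
  proof
    fix f assume "f \<in> A ` I \<union> fcnj ` K"
    then have "f v = 0" if "v \<notin> W" for v
      using assms(4,7) that by (auto simp: row_kernel_iff fcnj_def vec_eq_iff)
    then show "f \<in> fvec.span (coord_vectors W)"
      using assms(1) by (rule supported_in_span_coord_vectors[rotated])
  qed
  then have "card (A ` I \<union> fcnj ` K) \<le> card (coord_vectors W :: ('v \<Rightarrow> complex ^ 'n) set)"
    using fvec.independent_span_bound[OF finite_coord_vectors[OF assms(1)] conjunct1[OF *]] by simp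
  moreover have "card (A ` I \<union> fcnj ` K) = card I + card K"
    using * assms(2,5) A(1) card_Un_disjoint[of "A ` I" "fcnj ` K"]
    by (simp add: card_image inj_on_def[of fcnj])
  ultimately show ?thesis using card_coord_vectors[OF assms(1), where 'a=complex and 'n='n]
    by linarith
qed

text \<open>An infinite basis would have cardinality 0, hence the basis is first shown finite, by
  the support condition, and then nonempty.\<close>

lemma dim_row_kernel_ge_1:
  assumes "finite W" "x \<in> row_kernel A I W" "x \<noteq> 0"
  shows "fvec.dim (row_kernel A I W) \<ge> 1"
proof -
  obtain B where B: "B \<subseteq> row_kernel A I W" "fvec.independent B" "row_kernel A I W \<subseteq> fvec.span B"
    "card B = fvec.dim (row_kernel A I W)"
    using fvec.basis_exists by blast
  have "B \<subseteq> fvec.span (coord_vectors W)"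
    using B(1) assms(1) by (auto simp: row_kernel_iff intro!: supported_in_span_coord_vectors)
  then have "finite B"
    using fvec.independent_span_bound[OF finite_coord_vectors[OF assms(1)] B(2)] by simp
  moreover have "B \<noteq> {}" using B(3) assms(2,3) by auto
  ultimately show ?thesis using B(4) by (metis One_nat_def Suc_leI card_gt_0_iff)
qed

subsection \<open>Orbit matrices\<close>

text \<open>Turns the absence of linear relations among a family into independence of its image.
  Injectivity comes along because \<open>f i = f j\<close> would give a relation with coefficients 1
  and -1.\<close>

lemma independent_image_of_family:
  fixes f :: "'i \<Rightarrow> 'v \<Rightarrow> 'a::field ^ 'n"
  assumes "finite I" and "\<And>c i. (\<Sum>i\<in>I. vscale (c i) (f i)) = 0 \<Longrightarrow> i \<in> I \<Longrightarrow> c i = 0"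
  shows "inj_on f I" "fvec.independent (f ` I)"
proof -
  show inj: "inj_on f I"
  proof (rule inj_onI, rule ccontr)
    fix i j assume ij: "i \<in> I" "j \<in> I" "f i = f j" "i \<noteq> j"
    define c where "c l = (if l = i then 1 else if l = j then - 1 else 0 :: 'a)" for l
    have "(\<Sum>l\<in>I. vscale (c l) (f l)) = (\<Sum>l\<in>{i, j}. vscale (c l) (f l))"
      using ij assms(1) by (intro sum.mono_neutral_right) (auto simp: c_def)
    also have "\<dots> = 0" using ij by (simp add: c_def)
    finally have "c i = 0" using assms(2) ij(1) by blast
    then show False by (simp add: c_def)
  qed
  show "fvec.independent (f ` I)"
  proof
    assume "fvec.dependent (f ` I)"
    then obtain u v where "v \<in> I" "u (f v) \<noteq> 0" and "(\<Sum>w\<in>f ` I. vscale (u w) w) = 0"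
      using fvec.dependent_finite[of "f ` I"] assms(1) by auto
    moreover from this have "(\<Sum>i\<in>I. vscale (u (f i)) (f i)) = 0"
      using inj by (simp add: sum.reindex)
    ultimately show False using assms(2)[of "\<lambda>i. u (f i)"] by blast
  qed
qed

section \<open>Complexification and the rows of the orbit matrix\<close>

definition cmat :: "real ^ 'n ^ 'm \<Rightarrow> complex ^ 'n ^ 'm" where
  "cmat A = (\<chi> i j. complex_of_real (A $ i $ j))"

text \<open>The dot product that is bilinear over the field, unlike \<open>inner\<close>, which is
  real-valued on complex vectors.\<close>

definition bdot :: "'a::field ^ 'n \<Rightarrow> 'a ^ 'n \<Rightarrow> 'a" where
  "bdot a x = (\<Sum>i\<in>UNIV. a $ i * x $ i)"

lemma bdot_simps [simp]:
  "bdot (a + b) x = bdot a x + bdot b x" "bdot (- a) x = - bdot a x" "bdot (c *s a) x = c * bdot a x"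
  "bdot a (x + y) = bdot a x + bdot a y" "bdot a (x - y) = bdot a x - bdot a y"
  "bdot a (c *s x) = c * bdot a x" "bdot a 0 = 0" "bdot 0 x = 0"
  by (simp_all add: bdot_def algebra_simps sum.distrib sum_subtractf sum_distrib_left sum_negf)

lemma cmat_mult: "cmat (A ** B) = cmat A ** cmat B"
  by (simp add: cmat_def matrix_matrix_mult_def vec_eq_iff)

lemma cmat_id: "cmat (mat 1) = mat 1"
  by (simp add: cmat_def mat_def vec_eq_iff)

lemma cvec_0: "cvec 0 = 0"
  by (simp add: cvec_def vec_eq_iff)

lemma cvec_uminus: "cvec (- x) = - cvec x"
  by (simp add: cvec_def vec_eq_iff)

text \<open>Transposition is adjunction for \<open>bdot\<close>; this moves a matrix from the motion
  to the row.\<close>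

lemma bdot_cvec_cmat: "bdot (cvec a) (cmat A *v x) = bdot (cvec (transpose A *v a)) x"
proof -
  have "bdot (cvec a) (cmat A *v x) = (\<Sum>i\<in>UNIV. \<Sum>j\<in>UNIV. a $ i * (A $ i $ j * x $ j))"
    by (simp add: bdot_def cvec_def cmat_def matrix_vector_mult_def sum_distrib_left)
  also have "\<dots> = (\<Sum>j\<in>UNIV. \<Sum>i\<in>UNIV. a $ i * (A $ i $ j * x $ j))"
    by (rule sum.swap)
  also have "\<dots> = bdot (cvec (transpose A *v a)) x"
    by (simp add: bdot_def cvec_def transpose_def matrix_vector_mult_def sum_distrib_left mult_ac)
  finally show ?thesis .
qed

lemma orthogonal_matrix_inv:
  fixes A :: "real ^ 'n ^ 'n"
  assumes "orthogonal_matrix A"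
  shows "matrix_inv A = transpose A"
proof -
  have "A ** matrix_inv A = mat 1 \<and> matrix_inv A ** A = mat 1"
    unfolding matrix_inv_def by (rule someI[where x = "transpose A"])
      (use assms in \<open>simp add: orthogonal_matrix_def\<close>)
  then have "transpose A ** (A ** matrix_inv A) = transpose A" by simp
  then show ?thesis
    using assms by (simp add: matrix_mul_assoc orthogonal_matrix_def)
qed

text \<open>Since the gain matrix \<open>A\<close> is orthogonal, the block of the head is
  \<open>- transpose A\<close> applied to the block of the tail, up to the root of unity. A row thus
  tests one vector against a twisted difference of velocities. Loops are covered because the two
  blocks enter as separate summands.\<close>

lemma pairing_orbit_matrix:
  fixes \<tau> :: "int \<Rightarrow> real ^ 2 ^ 2"
  assumes W: "finite W" "tail H e \<in> W" "head H e \<in> W" and A: "orthogonal_matrix (\<tau> (\<psi> e))"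
  shows "pairing W (orbit_matrix k \<tau> j H \<psi> p e) x =
    bdot (cvec (p (tail H e) - \<tau> (\<psi> e) *v p (head H e)))
      (x (tail H e) -
       (exp (2 * of_real pi * \<i> / of_nat k) powi (int j * \<psi> e)) *s (cmat (\<tau> (\<psi> e)) *v x (head H e)))"
proof -
  let ?u = "tail H e" and ?v = "head H e" and ?A = "\<tau> (\<psi> e)"
  define c where "c = exp (2 * of_real pi * \<i> / of_nat k) powi (int j * \<psi> e)"
  define a where "a = cvec (p ?u - ?A *v p ?v)"
  define b where "b = cvec (p ?v - matrix_inv ?A *v p ?u)"
  have b: "b = - cvec (transpose ?A *v (p ?u - ?A *v p ?v))"
    using A by (simp add: b_def orthogonal_matrix_inv matrix_vector_mult_diff_distrib
        matrix_vector_mul_assoc orthogonal_matrix_def flip: cvec_uminus)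
  have "pairing W (orbit_matrix k \<tau> j H \<psi> p e) x
      = (\<Sum>w\<in>W. (if w = ?u then bdot a (x w) else 0) + (if w = ?v then bdot (c *s b) (x w) else 0))"
    unfolding pairing_def
    by (intro sum.cong refl)
      (auto simp: orbit_matrix_def Let_def bdot_def a_def b_def c_def algebra_simps sum.distrib sum_distrib_left)
  also have "\<dots> = bdot a (x ?u) + c * bdot b (x ?v)"
    using W by (simp add: sum.distrib)
  also have "\<dots> = bdot a (x ?u - c *s (cmat ?A *v x ?v))"
    by (simp add: b a_def bdot_cvec_cmat)
  finally show ?thesis by (simp add: a_def c_def)
qed

text \<open>If the ends of a lifted edge coincide, applying the inverse gain matrix shows that the
  block of the head vanishes along with that of the tail.\<close>

lemma orbit_matrix_eq_0:
  assumes "orthogonal_matrix (\<tau> (\<psi> e))" "p (tail H e) = \<tau> (\<psi> e) *v p (head H e)"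
  shows "orbit_matrix k \<tau> j H \<psi> p e = 0"
proof -
  have "matrix_inv (\<tau> (\<psi> e)) *v (\<tau> (\<psi> e) *v x) = x" for x
    using assms(1) by (simp add: orthogonal_matrix_inv matrix_vector_mul_assoc orthogonal_matrix_def)
  then have z: "p (tail H e) - \<tau> (\<psi> e) *v p (head H e) = 0"
    "p (head H e) - matrix_inv (\<tau> (\<psi> e)) *v p (tail H e) = 0"
    unfolding assms(2) by simp_all
  show ?thesis
    unfolding orbit_matrix_def Let_def z cvec_0 by (simp add: fun_eq_iff)
qed

section \<open>Plane rotations\<close>

lemma group_orthogonal_group2: "group orthogonal_group2"
proof (rule groupI)
  fix A assume "A \<in> carrier orthogonal_group2"
  then show "\<exists>B\<in>carrier orthogonal_group2. B \<otimes>\<^bsub>orthogonal_group2\<^esub> A = \<one>\<^bsub>orthogonal_group2\<^esub>"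
    by (intro bexI[of _ "transpose A"]) (auto simp: orthogonal_group2_def orthogonal_matrix_def)
qed (auto simp: orthogonal_group2_def orthogonal_matrix_mul orthogonal_matrix_id matrix_mul_assoc)

text \<open>The vectors (1, i) and (1, -i) are eigenvectors of the rotation by \<open>t\<close>,
  with eigenvalues \<open>cis (- t)\<close> and \<open>cis t\<close>; the scalar in front cancels
  the eigenvalue.\<close>

lemma rotation_eigenvector:
  "cis t *s (cmat (rotation t) *v vector [1, \<i>]) = (vector [1, \<i>] :: complex ^ 2)"
  "cis (- t) *s (cmat (rotation t) *v vector [1, - \<i>]) = (vector [1, - \<i>] :: complex ^ 2)"
  using sin_cos_squared_add[of t]
  by (auto simp: vec_eq_iff forall_2 cmat_def rotation_def matrix_vector_mult_def sum_2 vector_2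
      complex_eq_iff power2_eq_square algebra_simps)

subsection \<open>Motions of symmetric frameworks\<close>

locale cyclic_rep =
  fixes k :: nat and \<tau> :: "int \<Rightarrow> real ^ 2 ^ 2"
  assumes rep: "faithful_rep k \<tau>" and k_pos: "k > 0"
begin

text \<open>Extends the representation to all integers by reduction mod \<open>k\<close>, so that
  integer potentials and their negatives are admissible arguments.\<close>

definition M :: "int \<Rightarrow> real ^ 2 ^ 2" where
  "M g = \<tau> (g mod int k)"

text \<open>The \<open>j\<close>-th character of the cyclic group, likewise on all integers.\<close>

definition \<zeta> :: "nat \<Rightarrow> int \<Rightarrow> complex" where
  "\<zeta> j g = exp (2 * of_real pi * \<i> / of_nat k) powi (int j * g)"

lemma orthogonal_rep:
  assumes "g \<in> carrier (integer_mod_group k)"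
  shows "orthogonal_matrix (\<tau> g)"
proof -
  have "\<tau> g \<in> carrier (cyclic_rotation_group k)"
    using rep assms by (auto simp: faithful_rep_def mon_def hom_def)
  then have "\<tau> g \<in> carrier orthogonal_group2"
    unfolding cyclic_rotation_group_def
    using group.carrier_subgroup_generated_subset[OF group_orthogonal_group2] by blast
  then show ?thesis by (simp add: orthogonal_group2_def)
qed

lemma mod_carrier: "g mod int k \<in> carrier (integer_mod_group k)"
  using k_pos by (simp add: carrier_integer_mod_group)

lemma M_eq: "g \<in> carrier (integer_mod_group k) \<Longrightarrow> \<tau> g = M g"
  using k_pos by (simp add: carrier_integer_mod_group M_def)

lemma M_cong: "int k dvd a - b \<Longrightarrow> M a = M b"
  by (simp add: M_def mod_eq_dvd_iff[THEN iffD2])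

lemma orthogonal_M: "orthogonal_matrix (M g)"
  unfolding M_def by (intro orthogonal_rep mod_carrier)

lemma M_add: "M (a + b) = M a ** M b"
proof -
  have "\<tau> \<in> hom (integer_mod_group k) (cyclic_rotation_group k)"
    using rep by (simp add: faithful_rep_def mon_def)
  from hom_mult[OF this mod_carrier mod_carrier, of a b] show ?thesis
    by (simp add: M_def cyclic_rotation_group_def orthogonal_group2_def subgroup_generated_def mod_simps)
qed

lemma M_0: "M 0 = mat 1"
proof -
  have "transpose (M 0) ** (M 0 ** M 0) = transpose (M 0) ** M 0"
    using M_add[of 0 0] by simp
  then show ?thesis
    using orthogonal_M[of 0] by (simp add: matrix_mul_assoc orthogonal_matrix_def)
qed

lemma M_vec_add: "M a *v (M b *v x) = M (a + b) *v x"
  by (simp add: M_add matrix_vector_mul_assoc)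

lemma cmat_M_vec_add: "cmat (M a) *v (cmat (M b) *v x) = cmat (M (a + b)) *v x"
  by (simp add: M_add cmat_mult matrix_vector_mul_assoc)

lemma \<zeta>_add: "\<zeta> j (a + b) = \<zeta> j a * \<zeta> j b"
  by (simp add: \<zeta>_def power_int_add distrib_left)

lemma \<zeta>_0: "\<zeta> j 0 = 1"
  by (simp add: \<zeta>_def)

lemma root_of_unity_power: "exp (2 * of_real pi * \<i> / of_nat k) ^ k = 1"
proof -
  have "exp (2 * of_real pi * \<i> / of_nat k) ^ k = exp (of_nat k * (2 * of_real pi * \<i> / of_nat k))"
    by (rule exp_of_nat_mult[symmetric])
  also have "\<dots> = 1" using k_pos by simp
  finally show ?thesis .
qed

lemma \<zeta>_cong:
  assumes "int k dvd a - b"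
  shows "\<zeta> j a = \<zeta> j b"
proof -
  from assms obtain m where m: "a = b + int k * m"
    by (metis add.commute diff_add_cancel dvdE)
  have "\<zeta> j (int k * m) = (exp (2 * of_real pi * \<i> / of_nat k) powi int k) powi (int j * m)"
    unfolding \<zeta>_def power_int_mult[symmetric] by (simp add: mult_ac)
  also have "\<dots> = 1" by (simp add: root_of_unity_power)
  finally show ?thesis by (simp add: m \<zeta>_add)
qed

lemma \<zeta>_nonzero: "\<zeta> j g \<noteq> 0"
  by (simp add: \<zeta>_def)

lemma M_uminus_transpose: "transpose (M g) = M (- g)"
proof -
  have "M (- g) ** M g = mat 1"
    using M_add[of "- g" g] M_0 by simp
  then have "M (- g) ** M g ** transpose (M g) = transpose (M g)" by simp
  then show ?thesis
    using orthogonal_M[of g] by (simp add: orthogonal_matrix_def flip: matrix_mul_assoc)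
qed

end

locale cyclic_gain_graph = cyclic_rep k \<tau> for k \<tau> +
  fixes H :: "('v, 'e) pre_digraph" and \<psi> :: "'e \<Rightarrow> int" and p :: "'v \<Rightarrow> real ^ 2"
  assumes gain_graph: "gain_graph (integer_mod_group k) H \<psi>"
begin

lemma finite_arcs: "finite (arcs H)" and finite_verts: "finite (verts H)" and verts_nonempty: "verts H \<noteq> {}"
  and gain_carrier: "e \<in> arcs H \<Longrightarrow> \<psi> e \<in> carrier (integer_mod_group k)"
  and ends_in_verts: "e \<in> arcs H \<Longrightarrow> tail H e \<in> verts H \<and> head H e \<in> verts H"
proof -
  interpret fin_digraph H using gain_graph by (simp add: gain_graph_def)
  show "finite (arcs H)" "finite (verts H)" by simp_all
  show "e \<in> arcs H \<Longrightarrow> tail H e \<in> verts H \<and> head H e \<in> verts H" by simp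
  show "verts H \<noteq> {}" "e \<in> arcs H \<Longrightarrow> \<psi> e \<in> carrier (integer_mod_group k)"
    using gain_graph by (auto simp: gain_graph_def)
qed

lemma pairing_orbit:
  assumes "e \<in> arcs H" "finite W" "tail H e \<in> W" "head H e \<in> W"
  shows "pairing W (orbit_matrix k \<tau> j H \<psi> p e) x =
    bdot (cvec (p (tail H e) - M (\<psi> e) *v p (head H e)))
      (x (tail H e) - \<zeta> j (\<psi> e) *s (cmat (M (\<psi> e)) *v x (head H e)))"
  using pairing_orbit_matrix[of W H e \<tau> \<psi> k j p x] assms orthogonal_rep[OF gain_carrier]
    M_eq[OF gain_carrier] by (simp add: \<zeta>_def)

text \<open>
  A symmetric infinitesimal motion of the covering framework, switched back by the potential \<open>h\<close>
  of a balanced edge set.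
\<close>

definition switched :: "nat \<Rightarrow> ('v \<Rightarrow> int) \<Rightarrow> 'v set \<Rightarrow> ('v \<Rightarrow> complex ^ 2) \<Rightarrow> 'v \<Rightarrow> complex ^ 2" where
  "switched j h W y = (\<lambda>v. if v \<in> W then \<zeta> j (- h v) *s (cmat (M (- h v)) *v y v) else 0)"

lemma switched_add: "switched j h W (y + z) = switched j h W y + switched j h W z"
  and switched_vscale: "switched j h W (vscale c y) = vscale c (switched j h W y)"
  by (auto simp: switched_def vscale_def fun_eq_iff vec.add vec.scale algebra_simps)

text \<open>Switching is invertible at each vertex of \<open>W\<close>: \<open>M (h v)\<close>
  undoes \<open>M (- h v)\<close> and the character does not vanish.\<close>

lemma switched_eq_0:
  assumes "switched j h W y = 0" "v \<in> W"
  shows "y v = 0"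
proof -
  have "\<zeta> j (- h v) *s (cmat (M (- h v)) *v y v) = 0"
    using fun_cong[OF assms(1), of v] assms(2) by (simp add: switched_def)
  then have "cmat (M (- h v)) *v y v = 0" by (simp add: \<zeta>_nonzero)
  then have "cmat (M (h v)) *v (cmat (M (- h v)) *v y v) = 0" by simp
  then show ?thesis by (simp add: cmat_M_vec_add M_0 cmat_id)
qed

text \<open>Modulo \<open>k\<close> the gain of \<open>e\<close> is a difference of potentials, so
  the twist splits between the two ends and cancels against the switching. What remains, up to a
  scalar, is an ordinary rigidity row at the switched points \<open>q\<close>.\<close>

lemma pairing_switched:
  assumes e: "e \<in> arcs H" and W: "finite W" "tail H e \<in> W" "head H e \<in> W"
    and h: "int k dvd \<psi> e - (h (head H e) - h (tail H e))"
  defines "q \<equiv> \<lambda>v. M (h v) *v p v"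
  shows "pairing W (orbit_matrix k \<tau> j H \<psi> p e) (switched j h W y) =
    \<zeta> j (- h (tail H e)) * bdot (cvec (q (tail H e) - q (head H e))) (y (tail H e) - y (head H e))"
proof -
  let ?u = "tail H e" and ?v = "head H e"
  have eq: "M (\<psi> e) = M (- h ?u + h ?v)" "\<zeta> j (\<psi> e) = \<zeta> j (- h ?u + h ?v)"
    using h by (auto intro!: M_cong \<zeta>_cong)
  have "switched j h W y ?u - \<zeta> j (\<psi> e) *s (cmat (M (\<psi> e)) *v switched j h W y ?v)
      = \<zeta> j (- h ?u) *s (cmat (M (- h ?u)) *v y ?u)
        - (\<zeta> j (- h ?u + h ?v) * \<zeta> j (- h ?v)) *s (cmat (M (- h ?u + h ?v)) *v (cmat (M (- h ?v)) *v y ?v))"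
    using W by (simp add: switched_def eq vec.scale)
  also have "\<dots> = \<zeta> j (- h ?u) *s (cmat (M (- h ?u)) *v (y ?u - y ?v))"
    unfolding cmat_M_vec_add \<zeta>_add[symmetric] by (simp add: vec.diff algebra_simps)
  finally have 1: "switched j h W y ?u - \<zeta> j (\<psi> e) *s (cmat (M (\<psi> e)) *v switched j h W y ?v)
      = \<zeta> j (- h ?u) *s (cmat (M (- h ?u)) *v (y ?u - y ?v))" .
  have 2: "transpose (M (- h ?u)) *v (p ?u - M (\<psi> e) *v p ?v) = q ?u - q ?v"
    unfolding M_uminus_transpose eq q_def matrix_vector_mult_diff_distrib M_vec_add by simp
  show ?thesis
    unfolding pairing_orbit[OF e W] 1 bdot_simps(6) bdot_cvec_cmat 2 ..
qed

section \<open>Counting edges by means of kernel vectors\<close>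

lemma finite_edge_verts:
  assumes "F \<subseteq> arcs H"
  shows "finite (edge_verts H F)"
  using finite_subset[OF assms finite_arcs] by (auto simp: edge_verts_def)

lemma edge_verts_nonempty: "F \<noteq> {} \<Longrightarrow> edge_verts H F \<noteq> {}"
  by (auto simp: edge_verts_def)

lemma card_plus_card_kernel_le:
  assumes "row_independent (orbit_matrix k \<tau> j H \<psi> p) (arcs H)" "F \<subseteq> arcs H"
    and "finite K" "fvec.independent K"
    and "K \<subseteq> row_kernel (orbit_matrix k \<tau> j H \<psi> p) F (edge_verts H F)"
  shows "card F + card K \<le> 2 * card (edge_verts H F)"
proof -
  have "finite F" using assms(2) finite_arcs finite_subset by blast
  moreover have "row_independent (orbit_matrix k \<tau> j H \<psi> p) F"
    using assms(1,2) unfolding row_independent_def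
    by (meson fvec.independent_mono image_mono inj_on_subset)
  moreover have "orbit_matrix k \<tau> j H \<psi> p e v = 0" if "e \<in> F" "v \<notin> edge_verts H F" for e v
    using that by (auto simp: orbit_matrix_def Let_def edge_verts_def)
  ultimately show ?thesis
    using card_rows_plus_card_kernel_le[of "edge_verts H F" F "orbit_matrix k \<tau> j H \<psi> p" K] assms(3-)
    by (simp add: edge_verts_def)
qed

lemma orbit_row_nonzero:
  assumes "row_independent (orbit_matrix k \<tau> j H \<psi> p) (arcs H)" "e \<in> arcs H"
  shows "p (tail H e) \<noteq> M (\<psi> e) *v p (head H e)"
proof
  assume "p (tail H e) = M (\<psi> e) *v p (head H e)"
  then have "orbit_matrix k \<tau> j H \<psi> p e = 0"
    using orthogonal_rep[OF gain_carrier] M_eq[OF gain_carrier] assms(2) by (intro orbit_matrix_eq_0) auto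
  then have "0 \<in> orbit_matrix k \<tau> j H \<psi> p ` arcs H" using assms(2) by force
  then show False using assms(1) fvec.dependent_zero by (auto simp: row_independent_def)
qed

text \<open>The velocity field of the rotations about the origin.\<close>

definition rot90 :: "real ^ 2 \<Rightarrow> real ^ 2" where
  "rot90 x = vector [- (x $ 2), x $ 1]"

lemma bdot_rot90: "bdot (cvec (x - y)) (cvec (rot90 x) - cvec (rot90 y)) = 0"
  by (simp add: bdot_def cvec_def rot90_def sum_2 vector_2 algebra_simps)

lemma card_balanced_le:
  assumes ind: "row_independent (orbit_matrix k \<tau> j H \<psi> p) (arcs H)"
    and F: "F \<subseteq> arcs H" "F \<noteq> {}" "balanced (integer_mod_group k) H \<psi> F"
  shows "card F + 3 \<le> 2 * card (edge_verts H F)"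
proof -
  let ?W = "edge_verts H F"
  note W = finite_edge_verts[OF F(1)]
  have \<psi>: "\<psi> \<in> F \<rightarrow> carrier (integer_mod_group k)" using F(1) gain_carrier by auto
  obtain h where h: "\<And>e. e \<in> F \<Longrightarrow> int k dvd \<psi> e - (h (head H e) - h (tail H e))"
    using balanced_potential[OF F(3) \<psi>] by blast
  define q where "q v = M (h v) *v p v" for v
  \<comment> \<open>\<open>Y 0\<close> and \<open>Y 1\<close> are the two translations,
    \<open>Y 2\<close> is the infinitesimal rotation of the switched points.\<close>
  define Y where "Y i v = (if i = 0 then axis 1 1 else if i = 1 then axis 2 1 else cvec (rot90 (q v)))"
    for i :: nat and v
  have comb: "(\<Sum>i\<in>{0, 1, 2}. vscale (c i) (switched j h ?W (Y i)))
      = switched j h ?W (vscale (c 0) (Y 0) + vscale (c 1) (Y 1) + vscale (c 2) (Y 2))" for c :: "nat \<Rightarrow> complex"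
    by (simp add: switched_add switched_vscale add.assoc)
  have lin: "c i = 0"
    if 0: "(\<Sum>i\<in>{0, 1, 2}. vscale (c i) (switched j h ?W (Y i))) = 0" and i: "i \<in> {0, 1, 2}" for c i
  proof -
    \<comment> \<open>At each vertex a relation determines the translation part from
      \<open>c 2\<close> and the point \<open>q v\<close>. Two different points therefore force
      \<open>c 2 = 0\<close>.\<close>
    have eqs: "c 0 = c 2 * of_real (q v $ 2) \<and> c 1 = - (c 2 * of_real (q v $ 1))" if "v \<in> ?W" for v
      using switched_eq_0[OF 0[unfolded comb] that]
      by (simp add: vscale_def Y_def rot90_def cvec_def vec_eq_iff forall_2 vector_2 axis_def
          eq_neg_iff_add_eq_0)
    obtain e where e: "e \<in> F" using F(2) by blast
    let ?u = "tail H e" and ?v = "head H e"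
    have uv: "?u \<in> ?W" "?v \<in> ?W" using e by (auto simp: edge_verts_def)
    \<comment> \<open>Coincidence of these two points would make the row of \<open>e\<close> zero,
      against independence.\<close>
    have "q ?u \<noteq> q ?v"
    proof
      assume "q ?u = q ?v"
      then have "M (- h ?u) *v q ?u = M (- h ?u) *v q ?v" by simp
      then have "p ?u = M (- h ?u + h ?v) *v p ?v"
        unfolding q_def M_vec_add by (simp add: M_0)
      moreover have "M (\<psi> e) = M (- h ?u + h ?v)" using h[OF e] by (auto intro!: M_cong)
      ultimately have "p ?u = M (\<psi> e) *v p ?v" by (simp only:)
      then show False using orbit_row_nonzero[OF ind] e F(1) by blast
    qed
    then have "q ?u $ 1 \<noteq> q ?v $ 1 \<or> q ?u $ 2 \<noteq> q ?v $ 2" by (simp add: vec_eq_iff forall_2)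
    moreover have "c 2 * of_real (q ?u $ 1) = c 2 * of_real (q ?v $ 1)"
      "c 2 * of_real (q ?u $ 2) = c 2 * of_real (q ?v $ 2)"
      using eqs[OF uv(1)] eqs[OF uv(2)] by (metis neg_equal_iff_equal)+
    ultimately have "c 2 = 0" by auto
    then show "c i = 0" using eqs[OF uv(1)] i by auto
  qed
  have indep: "inj_on (\<lambda>i. switched j h ?W (Y i)) {0, 1, 2}"
    "fvec.independent ((\<lambda>i. switched j h ?W (Y i)) ` {0, 1, 2})"
    by (rule independent_image_of_family, simp, erule (1) lin)+
  have ker: "(\<lambda>i. switched j h ?W (Y i)) ` {0, 1, 2} \<subseteq> row_kernel (orbit_matrix k \<tau> j H \<psi> p) F ?W"
  proof (rule image_subsetI)
    fix i :: nat
    have "pairing ?W (orbit_matrix k \<tau> j H \<psi> p e) (switched j h ?W (Y i)) = 0" if e: "e \<in> F" for e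
    proof -
      have eW: "e \<in> arcs H" "tail H e \<in> ?W" "head H e \<in> ?W"
        using e F(1) by (auto simp: edge_verts_def)
      have "bdot (cvec (q (tail H e) - q (head H e))) (Y i (tail H e) - Y i (head H e)) = 0"
        using bdot_rot90 by (simp add: Y_def del: bdot_simps(5))
      then show ?thesis
        using pairing_switched[OF eW(1) W eW(2,3) h[OF e], of j "Y i"] unfolding q_def by (simp only: mult_zero_right)
    qed
    then show "switched j h ?W (Y i) \<in> row_kernel (orbit_matrix k \<tau> j H \<psi> p) F ?W"
      by (simp add: row_kernel_iff) (simp add: switched_def)
  qed
  have "card ((\<lambda>i. switched j h ?W (Y i)) ` {0, 1, 2::nat}) = 3"
    using indep(1) by (subst card_image) auto
  then show ?thesis
    using card_plus_card_kernel_le[OF ind F(1) _ indep(2) ker] by simp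
qed

section \<open>Constant motions\<close>

definition const_motion :: "'v set \<Rightarrow> complex ^ 2 \<Rightarrow> 'v \<Rightarrow> complex ^ 2" where
  "const_motion W z = (\<lambda>v. if v \<in> W then z else 0)"

text \<open>A vector fixed by the twist of the generator is fixed by that of its multiples.
  Nonnegative \<open>g\<close> suffice, as the elements of the group are represented by 0, ...,
  \<open>k - 1\<close>.\<close>

lemma twist_fixed:
  assumes "\<zeta> j 1 *s (cmat (M 1) *v z) = z" "g \<ge> 0"
  shows "\<zeta> j g *s (cmat (M g) *v z) = z"
  using assms(2)
proof (induction g rule: int_ge_induct)
  case base
  show ?case by (simp add: \<zeta>_0 M_0 cmat_id)
next
  case (step g)
  have "\<zeta> j (g + 1) *s (cmat (M (g + 1)) *v z)
      = \<zeta> j g *s (cmat (M g) *v (\<zeta> j 1 *s (cmat (M 1) *v z)))"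
    by (simp add: \<zeta>_add vec.scale cmat_M_vec_add)
  then show ?case using assms(1) step by simp
qed

lemma const_motion_in_kernel:
  assumes z: "\<zeta> j 1 *s (cmat (M 1) *v z) = z"
    and W: "finite W" "edge_verts H F \<subseteq> W" "F \<subseteq> arcs H"
  shows "const_motion W z \<in> row_kernel (orbit_matrix k \<tau> j H \<psi> p) F W"
proof -
  have "pairing W (orbit_matrix k \<tau> j H \<psi> p e) (const_motion W z) = 0" if e: "e \<in> F" for e
  proof -
    have "tail H e \<in> W" "head H e \<in> W" "e \<in> arcs H" using e W by (auto simp: edge_verts_def)
    moreover have "\<zeta> j (\<psi> e) *s (cmat (M (\<psi> e)) *v z) = z"
      using gain_carrier[OF \<open>e \<in> arcs H\<close>] k_pos
      by (intro twist_fixed[OF z]) (simp add: carrier_integer_mod_group)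
    ultimately show ?thesis
      using W(1) by (simp add: pairing_orbit const_motion_def)
  qed
  then show ?thesis by (simp add: row_kernel_iff) (simp add: const_motion_def)
qed

text \<open>The bound for balanced sets always comes from \<open>card_balanced_le\<close>, so only
  the count for arbitrary edge sets is left to supply.\<close>

lemma gain_sparseI:
  assumes "row_independent (orbit_matrix k \<tau> j H \<psi> p) (arcs H)"
    and "\<And>F. F \<subseteq> arcs H \<Longrightarrow> F \<noteq> {} \<Longrightarrow> card F + m \<le> 2 * card (edge_verts H F)"
  shows "gain_sparse (integer_mod_group k) H \<psi> 2 3 m"
  unfolding gain_sparse_def
proof (intro allI impI conjI)
  fix F assume F: "F \<subseteq> arcs H" "F \<noteq> {}"
  show "int (card F) \<le> int 2 * int (card (edge_verts H F)) - int m"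
    using assms(2)[OF F] by linarith
  assume "balanced (integer_mod_group k) H \<psi> F"
  then show "int (card F) \<le> int 2 * int (card (edge_verts H F)) - int 3"
    using card_balanced_le[OF assms(1) F] by linarith
qed

lemma gain_sparse_2_3_0:
  assumes "row_independent (orbit_matrix k \<tau> j H \<psi> p) (arcs H)"
  shows "gain_sparse (integer_mod_group k) H \<psi> 2 3 0"
  using card_plus_card_kernel_le[OF assms, where K = "{}"] fvec.independent_empty
  by (intro gain_sparseI[OF assms]) simp

lemma dim_kernel_ge_1:
  assumes "\<zeta> j 1 *s (cmat (M 1) *v z) = z" "z \<noteq> 0"
  shows "fvec.dim (row_kernel (orbit_matrix k \<tau> j H \<psi> p) (arcs H) (verts H)) \<ge> 1"
proof (rule dim_row_kernel_ge_1[OF finite_verts])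
  show "const_motion (verts H) z \<in> row_kernel (orbit_matrix k \<tau> j H \<psi> p) (arcs H) (verts H)"
    using ends_in_verts finite_verts
    by (intro const_motion_in_kernel[OF assms(1)]) (auto simp: edge_verts_def)
  show "const_motion (verts H) z \<noteq> 0"
    using verts_nonempty assms(2) by (auto simp: const_motion_def fun_eq_iff)
qed

lemma gain_sparse_2_3_1:
  assumes "row_independent (orbit_matrix k \<tau> j H \<psi> p) (arcs H)"
    and z: "\<zeta> j 1 *s (cmat (M 1) *v z) = z" "z \<noteq> 0"
  shows "gain_sparse (integer_mod_group k) H \<psi> 2 3 1"
proof (rule gain_sparseI[OF assms(1)])
  fix F assume F: "F \<subseteq> arcs H" "F \<noteq> {}"
  have "const_motion (edge_verts H F) z \<noteq> 0"
    using edge_verts_nonempty[OF F(2)] z(2) by (auto simp: const_motion_def fun_eq_iff)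
  then have "fvec.independent {const_motion (edge_verts H F) z}"
    by (simp add: fvec.independent_insert)
  then show "card F + 1 \<le> 2 * card (edge_verts H F)"
    using card_plus_card_kernel_le[OF assms(1) F(1), of "{const_motion (edge_verts H F) z}"]
      const_motion_in_kernel[OF z(1) finite_edge_verts[OF F(1)] subset_refl F(1)]
    by simp
qed

text \<open>When the twist is the identity, the constant motions along both coordinate axes lie in
  the kernel, and they are independent on a nonempty vertex set.\<close>

lemma gain_sparse_2_3_2:
  assumes "row_independent (orbit_matrix k \<tau> j H \<psi> p) (arcs H)"
    and z: "\<And>z. \<zeta> j 1 *s (cmat (M 1) *v z) = z"
  shows "gain_sparse (integer_mod_group k) H \<psi> 2 3 2"
proof (rule gain_sparseI[OF assms(1)])
  fix F assume F: "F \<subseteq> arcs H" "F \<noteq> {}"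
  let ?f = "\<lambda>i :: 2. const_motion (edge_verts H F) (axis i 1)"
  obtain v where v: "v \<in> edge_verts H F" using edge_verts_nonempty[OF F(2)] by blast
  have lin: "c i = 0" if "(\<Sum>i\<in>UNIV. vscale (c i) (?f i)) = 0" for c i
  proof -
    have "(\<Sum>i\<in>UNIV. vscale (c i) (?f i)) v $ i = 0" using that by simp
    then show "c i = 0"
      using v exhaust_2[of i]
      by (auto simp: sum_2 vscale_def const_motion_def axis_def)
  qed
  have indep: "inj ?f" "fvec.independent (range ?f)"
    by (rule independent_image_of_family, simp, erule lin)+
  have "range ?f \<subseteq> row_kernel (orbit_matrix k \<tau> j H \<psi> p) F (edge_verts H F)"
    using const_motion_in_kernel[OF z finite_edge_verts[OF F(1)] subset_refl F(1)] by blast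
  from card_plus_card_kernel_le[OF assms(1) F(1) _ indep(2) this]
  show "card F + 2 \<le> 2 * card (edge_verts H F)"
    using card_image[OF indep(1)] by simp
qed

section \<open>Fixed vectors of the twist\<close>

lemma \<zeta>_1: "\<zeta> 1 1 = cis (2 * pi / real k)"
  by (simp add: \<zeta>_def cis_conv_exp field_simps)

text \<open>The value depends only on the product of the two arguments of \<open>\<zeta>\<close>,
  and \<open>k - 1\<close> is congruent to -1.\<close>

lemma \<zeta>_pred: "\<zeta> (k - 1) 1 = cis (- (2 * pi / real k))"
proof -
  have "\<zeta> (k - 1) 1 = \<zeta> 1 (- 1)"
    using \<zeta>_cong[of "int k - 1" "- 1" 1] k_pos by (simp add: \<zeta>_def of_nat_diff)
  also have "\<dots> = cis (- (2 * pi / real k))"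
    using \<zeta>_1 by (simp add: \<zeta>_def power_int_minus cis_inverse[symmetric] del: cis_inverse)
  finally show ?thesis .
qed

text \<open>A faithful representation may send 1 to the rotation by 2 pi m / k for any m prime to k.
  The hypothesis on \<open>\<tau> 1\<close> selects m = 1 or m = -1, where the eigenvalues are
  exactly the two primitive roots whose inverses occur as \<open>\<zeta> j 1\<close>.\<close>

lemma twist_eigenvector:
  assumes k: "k \<ge> 2" and j: "j = 1 \<or> j = k - 1"
    and \<tau>: "\<tau> 1 = rotation (2 * pi / real k) \<or> \<tau> 1 = rotation (- (2 * pi / real k))"
  obtains z where "\<zeta> j 1 *s (cmat (M 1) *v z) = z" "z \<noteq> 0"
proof -
  have nz: "(vector [1, c] :: complex ^ 2) \<noteq> 0" for c
    by (simp add: vec_eq_iff forall_2 vector_2)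
  have M1: "M 1 = \<tau> 1" using k by (simp add: M_def)
  let ?t = "2 * pi / real k"
  have "\<zeta> j 1 = cis ?t \<or> \<zeta> j 1 = cis (- ?t)" using j \<zeta>_1 \<zeta>_pred by auto
  then show ?thesis
    using \<tau> that[OF _ nz] rotation_eigenvector[of ?t] rotation_eigenvector[of "- ?t"]
    unfolding M1 minus_minus by metis
qed

end

section \<open>The faithful representation for k = 2\<close>

lemma rotation_pi: "rotation pi = - mat 1"
  by (simp add: rotation_def vec_eq_iff forall_2 vector_2 mat_def)

text \<open>The group generated by \<open>- mat 1\<close> has only the elements \<open>mat 1\<close>
  and \<open>- mat 1\<close>, and injectivity excludes the former, which is the image of 0.\<close>

lemma faithful_rep_2:
  assumes "faithful_rep 2 \<tau>"
  shows "\<tau> 1 = - mat 1"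
proof -
  interpret cyclic_rep 2 \<tau> using assms by unfold_locales simp_all
  interpret O2: group orthogonal_group2 by (rule group_orthogonal_group2)
  have car: "0 \<in> carrier (integer_mod_group 2)" "1 \<in> carrier (integer_mod_group 2)" by simp_all
  have "x \<in> {mat 1, - mat 1}" if "x \<in> generate orthogonal_group2 {- mat 1}" for x
    using that
  proof induction
    case (inv h)
    have "- mat 1 \<in> carrier orthogonal_group2"
      by (auto simp: orthogonal_group2_def orthogonal_matrix_def transpose_def mat_def vec_eq_iff
          matrix_matrix_mult_def sum_2 forall_2)
    then have "inv\<^bsub>orthogonal_group2\<^esub> (- mat 1) = - mat 1"
      by (intro O2.inv_equality) (auto simp: orthogonal_group2_def mat_def vec_eq_iff
          matrix_matrix_mult_def sum_2 forall_2)
    then show ?case using inv by simp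
  qed (auto simp: orthogonal_group2_def mat_def vec_eq_iff matrix_matrix_mult_def sum_2 forall_2)
  moreover have "\<tau> 1 \<in> carrier (cyclic_rotation_group 2)"
    using assms car by (auto simp: faithful_rep_def mon_def hom_def)
  \<comment> \<open>\<open>subgroup_generated\<close> intersects the generators with the carrier;
    monotonicity removes the intersection.\<close>
  moreover have "generate orthogonal_group2 (carrier orthogonal_group2 \<inter> {- mat 1})
      \<subseteq> generate orthogonal_group2 {- mat 1}"
    by (intro O2.mono_generate) simp
  ultimately have "\<tau> 1 \<in> {mat 1, - mat 1}"
    by (auto simp: cyclic_rotation_group_def carrier_subgroup_generated rotation_pi)
  moreover have "\<tau> 1 \<noteq> \<tau> 0"
    using assms car by (auto simp: faithful_rep_def mon_def dest: inj_onD)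
  moreover have "\<tau> 0 = mat 1" using M_0 by (simp add: M_def)
  ultimately show ?thesis by auto
qed

theorem lemma6p7:
  fixes k :: nat
    and \<tau> :: "int \<Rightarrow> real ^ 2 ^ 2"
    and H :: "('v, 'e) pre_digraph"
    and \<psi> :: "'e \<Rightarrow> int"
    and p :: "'v \<Rightarrow> real ^ 2"
  assumes "faithful_rep k \<tau>"
    and "gain_graph (integer_mod_group k) H \<psi>"
    and "cyclic_regular k \<tau> H \<psi> p"
  shows
    "(k \<ge> 3 \<longrightarrow>
       (\<forall>j \<le> k - 1.
          (row_independent (orbit_matrix k \<tau> j H \<psi> p) (arcs H)
             \<longrightarrow> gain_sparse (integer_mod_group k) H \<psi> 2 3 0) \<and>
          ((j = 1 \<or> j = k - 1) \<and>
           (\<tau> 1 = rotation (2 * pi / real k) \<or> \<tau> 1 = rotation (- (2 * pi / real k)))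
             \<longrightarrow> fvec.dim (row_kernel (orbit_matrix k \<tau> j H \<psi> p) (arcs H) (verts H)) \<ge> 1 \<and>
                 (row_independent (orbit_matrix k \<tau> j H \<psi> p) (arcs H)
                    \<longrightarrow> gain_sparse (integer_mod_group k) H \<psi> 2 3 1)))) \<and>
     (k = 2 \<longrightarrow>
        row_independent (orbit_matrix k \<tau> 1 H \<psi> p) (arcs H)
          \<longrightarrow> gain_sparse (integer_mod_group k) H \<psi> 2 3 2)"
proof (intro conjI impI allI; (elim conjE)?)
  \<comment> \<open>Each half of the statement fixes or bounds \<open>k\<close> so that it is
    positive, as the locale requires.\<close>
  have loc: "cyclic_gain_graph k \<tau> H \<psi>" if "k > 0"
    using assms(1,2) that by unfold_locales
  {
    assume k: "k \<ge> 3"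
    interpret cyclic_gain_graph k \<tau> H \<psi> p using loc k by simp
    fix j
    show "row_independent (orbit_matrix k \<tau> j H \<psi> p) (arcs H) \<Longrightarrow> gain_sparse (integer_mod_group k) H \<psi> 2 3 0"
      by (rule gain_sparse_2_3_0)
    assume "j = 1 \<or> j = k - 1"
      and "\<tau> 1 = rotation (2 * pi / real k) \<or> \<tau> 1 = rotation (- (2 * pi / real k))"
    then obtain z where z: "\<zeta> j 1 *s (cmat (M 1) *v z) = z" "z \<noteq> 0"
      using twist_eigenvector k by (metis Suc_leD numeral_2_eq_2 numeral_3_eq_3)
    show "fvec.dim (row_kernel (orbit_matrix k \<tau> j H \<psi> p) (arcs H) (verts H)) \<ge> 1"
      using z by (rule dim_kernel_ge_1)
    show "row_independent (orbit_matrix k \<tau> j H \<psi> p) (arcs H) \<Longrightarrow> gain_sparse (integer_mod_group k) H \<psi> 2 3 1"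
      using z by (rule gain_sparse_2_3_1[rotated])
  }
  assume k: "k = 2" and ind: "row_independent (orbit_matrix k \<tau> 1 H \<psi> p) (arcs H)"
  interpret cyclic_gain_graph k \<tau> H \<psi> p using loc k by simp
  \<comment> \<open>For \<open>k = 2\<close> the root of unity is -1 and the generator acts as -1;
    the signs cancel, so every vector is fixed by the twist.\<close>
  have "\<zeta> 1 1 = - 1" using \<zeta>_1 k by simp
  moreover have "M 1 = - mat 1" unfolding M_def using assms(1) k by (simp add: faithful_rep_2)
  ultimately have "\<zeta> 1 1 *s (cmat (M 1) *v z) = z" for z
    by (simp add: cmat_def mat_def vec_eq_iff matrix_vector_mult_def forall_2 sum_2)
  then show "gain_sparse (integer_mod_group k) H \<psi> 2 3 2"
    by (rule gain_sparse_2_3_2[OF ind])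
qed

end
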